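(* For any prime $p$, $\mathrm{Char}(Z_{p^2}\times Z_{p^5})\cong\mathrm{Char}(Z_p\times Z_{p^2}\times Z_{p^4})$.
   Context: $\mathrm{Char}(G)$ denotes the lattice of characteristic subgroups of $G$. *)

theory Defs
  imports "HOL-Algebra.Algebra"
begin

definition characteristic :: "'a set \<Rightarrow> ('a, 'b) monoid_scheme \<Rightarrow> bool" where
  "characteristic H G \<longleftrightarrow> subgroup H G \<and> (\<forall>\<phi> \<in> iso G G. \<phi> ` H = H)"

definition Char :: "('a, 'b) monoid_scheme \<Rightarrow> 'a set set" where
  "Char G = {H. characteristic H G}"

text \<open>Lattice isomorphism between two families of sets ordered by inclusion
  (an order isomorphism, which for lattices is the same as a lattice isomorphism).\<close>
definition lattice_iso :: "'a set set \<Rightarrow> 'c set set \<Rightarrow> bool" where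
  "lattice_iso L M \<longleftrightarrow> (\<exists>f. bij_betw f L M \<and> (\<forall>A\<in>L. \<forall>B\<in>L. A \<subseteq> B \<longleftrightarrow> f A \<subseteq> f B))"

end

(*
  Lifting a subgroup of Z/p^a x Z/p^b x Z/p^c (a < b < c; the rank two group is the case a = 0) to a
  subgroup K of Z^3, characteristic subgroups become the K that contain p^a Z x p^b Z x p^c Z and are
  closed under the difference of certain automorphisms with the identity, that is, under the
  elementary off-diagonal endomorphisms and under the coordinate projections (for p = 2 only under
  their doubles, as units are congruent to 1 mod 2).  For odd p these K are the boxes
  p^i Z x p^j Z x p^k Z with exponents satisfying the evident inequalities, twelve for each of the two
  groups.  For p = 2 there are in addition four K in either case that contain a box B with index two,
  K = B u (w + B), where w halves the generators of B in two coordinates.  Both posets are finite and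
  explicit, and matching them is a finite check.
*)

theory Submission
  imports Defs "HOL-Library.Product_Plus" "HOL-Computational_Algebra.Primes"
begin

section \<open>Subgroups of the integer lattice closed under elementary endomorphisms\<close>

definition box :: "int \<Rightarrow> nat \<Rightarrow> nat \<Rightarrow> nat \<Rightarrow> (int \<times> int \<times> int) set" where
  "box p i j k = {(x, y, z). p ^ i dvd x \<and> p ^ j dvd y \<and> p ^ k dvd z}"

text \<open>Maps into a larger cyclic factor carry the power of \<open>p\<close> that turns
  multiples of \<open>p ^ a\<close> into multiples of \<open>p ^ b\<close>, and so on, so that the
  box with exponents \<open>a\<close>, \<open>b\<close>, \<open>c\<close> is respected. The
  projections are doubled for \<open>p = 2\<close> because doubling is an automorphism only of
  cyclic groups of odd order.\<close>

definition ops :: "int \<Rightarrow> nat \<Rightarrow> nat \<Rightarrow> nat \<Rightarrow> (int \<times> int \<times> int \<Rightarrow> int \<times> int \<times> int) set" where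
  "ops p a b c =
    {\<lambda>(x, y, z). (y, 0, 0), \<lambda>(x, y, z). (z, 0, 0), \<lambda>(x, y, z). (0, z, 0),
     \<lambda>(x, y, z). (0, p ^ (b - a) * x, 0), \<lambda>(x, y, z). (0, 0, p ^ (c - a) * x),
     \<lambda>(x, y, z). (0, 0, p ^ (c - b) * y)} \<union>
    (let d = if p = 2 then 2 else 1 in
      {\<lambda>(x, y, z). (d * x, 0, 0), \<lambda>(x, y, z). (0, d * y, 0), \<lambda>(x, y, z). (0, 0, d * z)})"

definition adm :: "int \<Rightarrow> nat \<Rightarrow> nat \<Rightarrow> nat \<Rightarrow> (int \<times> int \<times> int) set \<Rightarrow> bool" where
  "adm p a b c K \<longleftrightarrow> box p a b c \<subseteq> K \<and> (\<forall>u\<in>K. \<forall>v\<in>K. u - v \<in> K) \<and> (\<forall>f\<in>ops p a b c. \<forall>v\<in>K. f v \<in> K)"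

lemma mem_box [simp]: "(x, y, z) \<in> box p i j k \<longleftrightarrow> p ^ i dvd x \<and> p ^ j dvd y \<and> p ^ k dvd z"
  by (simp add: box_def)

lemma box_diff: "u \<in> box p i j k \<Longrightarrow> v \<in> box p i j k \<Longrightarrow> u - v \<in> box p i j k"
  by (auto simp: box_def)

lemma box_add: "u \<in> box p i j k \<Longrightarrow> v \<in> box p i j k \<Longrightarrow> u + v \<in> box p i j k"
  by (auto simp: box_def)

lemma prime_power_dvd_iff:
  fixes p :: int
  assumes "Factorial_Ring.prime p"
  shows "p ^ m dvd p ^ n \<longleftrightarrow> m \<le> n"
  using assms by (auto simp: dvd_power_iff)

lemma box_subset_iff:
  assumes "Factorial_Ring.prime p"
  shows "box p i j k \<subseteq> box p i' j' k' \<longleftrightarrow> i' \<le> i \<and> j' \<le> j \<and> k' \<le> k"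
proof
  assume L: "box p i j k \<subseteq> box p i' j' k'"
  \<comment> \<open>One element with exact divisibility in all three coordinates detects all three
    inequalities.\<close>
  have "(p ^ i, p ^ j, p ^ k) \<in> box p i j k" by simp
  with L have "(p ^ i, p ^ j, p ^ k) \<in> box p i' j' k'" by blast
  then show "i' \<le> i \<and> j' \<le> j \<and> k' \<le> k"
    using assms by (simp add: prime_power_dvd_iff)
next
  assume "i' \<le> i \<and> j' \<le> j \<and> k' \<le> k"
  then show "box p i j k \<subseteq> box p i' j' k'"
    by (auto simp: box_def intro: power_le_dvd)
qed

lemma ops_add: "f \<in> ops p a b c \<Longrightarrow> f (u + v) = f u + f v"
  by (cases u; cases v) (auto simp: ops_def Let_def algebra_simps)

lemma ops_diff: "f \<in> ops p a b c \<Longrightarrow> f (u - v) = f u - f v"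
  by (cases u; cases v) (auto simp: ops_def Let_def algebra_simps)

context
  fixes p :: int and a b c K
  assumes K: "adm p a b c K"
begin

lemma adm_lattice: "box p a b c \<subseteq> K"
  using K by (simp add: adm_def)

lemma adm_diff: "u \<in> K \<Longrightarrow> v \<in> K \<Longrightarrow> u - v \<in> K"
  using K by (simp add: adm_def)

lemma adm_op: "f \<in> ops p a b c \<Longrightarrow> v \<in> K \<Longrightarrow> f v \<in> K"
  using K by (simp add: adm_def)

lemma adm_zero: "(0, 0, 0) \<in> K"
  using adm_lattice by auto

lemma adm_minus: "v \<in> K \<Longrightarrow> - v \<in> K"
  using adm_diff[OF adm_zero, of v] by (cases v) simp

lemma adm_add: "u \<in> K \<Longrightarrow> v \<in> K \<Longrightarrow> u + v \<in> K"
  using adm_diff[OF _ adm_minus, of u v] by simp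

lemma adm_smult:
  assumes "(x, y, z) \<in> K"
  shows "(n * x, n * y, n * z) \<in> K"
proof (induction n rule: int_induct[where k = 0])
  case base
  then show ?case using adm_zero by simp
next
  case (step1 i)
  then show ?case using adm_add[OF step1(2) assms] by (simp add: algebra_simps)
next
  case (step2 i)
  then show ?case using adm_diff[OF step2(2) assms] by (simp add: algebra_simps)
qed

lemma adm_shear:
  assumes "(x, y, z) \<in> K"
  shows "(y, 0, 0) \<in> K" "(z, 0, 0) \<in> K" "(0, z, 0) \<in> K" "(0, p ^ (b - a) * x, 0) \<in> K"
    "(0, 0, p ^ (c - a) * x) \<in> K" "(0, 0, p ^ (c - b) * y) \<in> K"
  using adm_op[OF _ assms] by (force simp: ops_def)+

lemma adm_diag:
  assumes "(x, y, z) \<in> K"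
  shows "((if p = 2 then 2 else 1) * x, 0, 0) \<in> K" "(0, (if p = 2 then 2 else 1) * y, 0) \<in> K"
    "(0, 0, (if p = 2 then 2 else 1) * z) \<in> K"
  using adm_op[OF _ assms] by (force simp: ops_def Let_def)+

end

section \<open>Boxes closed under the operations, and odd primes\<close>

text \<open>The lower bounds \<open>i \<le> j\<close> and \<open>j \<le> k\<close> reflect the
  shears into the preceding coordinate, the last two inequalities the shears into the following one.
  The conditions linking the first and third coordinates follow from these.\<close>

definition canonical :: "nat \<Rightarrow> nat \<Rightarrow> nat \<Rightarrow> nat \<Rightarrow> nat \<Rightarrow> nat \<Rightarrow> bool" where
  "canonical a b c i j k \<longleftrightarrow>
    i \<le> a \<and> j \<le> b \<and> k \<le> c \<and> i \<le> j \<and> j \<le> k \<and> j \<le> i + (b - a) \<and> k \<le> j + (c - b)"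

lemma box_op:
  assumes "canonical a b c i j k" "a \<le> b" "b \<le> c" "f \<in> ops p a b c" "v \<in> box p i j k"
  shows "f v \<in> box p i j k"
proof -
  obtain x y z where v: "v = (x, y, z)" by (cases v)
  have le: "i \<le> j" "j \<le> k" "i \<le> k" "j \<le> (b - a) + i" "k \<le> (c - b) + j" "k \<le> (c - a) + i"
    using assms by (auto simp: canonical_def)
  have d: "p ^ i dvd x" "p ^ j dvd y" "p ^ k dvd z"
    using assms(5) by (auto simp: v)
  have "p ^ i dvd y" "p ^ i dvd z" "p ^ j dvd z"
    using d le by (meson power_le_dvd)+
  moreover have shift: "p ^ m dvd p ^ n * x'" if "m \<le> n + l" "p ^ l dvd x'" for m n l x'
    using power_le_dvd[OF _ that(1), of p "p ^ n * x'"] that(2) by (simp add: power_add mult_dvd_mono)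
  moreover have "p ^ j dvd p ^ (b - a) * x" "p ^ k dvd p ^ (c - a) * x" "p ^ k dvd p ^ (c - b) * y"
    using shift d le by blast+
  ultimately show ?thesis
    using assms(4) d by (auto simp: ops_def Let_def v split: if_splits)
qed

lemma adm_box:
  assumes "canonical a b c i j k" "a \<le> b" "b \<le> c"
  shows "adm p a b c (box p i j k)"
proof -
  have "box p a b c \<subseteq> box p i j k"
    using assms by (auto simp: canonical_def box_def intro: power_le_dvd)
  then show ?thesis
    using assms by (auto simp: adm_def box_diff box_op)
qed

text \<open>By Bezout the gcd of any element with \<open>p ^ n\<close> stays in \<open>S\<close>,
  and as a divisor of \<open>p ^ n\<close> it is a power of \<open>p\<close>. Hence the least power
  of \<open>p\<close> in \<open>S\<close> divides every element.\<close>

lemma prime_power_subgroup: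
  fixes p :: int
  assumes "Factorial_Ring.prime p" "p ^ n \<in> S" and diff: "\<And>x y. x \<in> S \<Longrightarrow> y \<in> S \<Longrightarrow> x - y \<in> S"
  obtains i where "i \<le> n" "\<And>x. x \<in> S \<longleftrightarrow> p ^ i dvd x"
proof -
  have 0: "0 \<in> S" using diff[OF assms(2,2)] by simp
  have minus: "- x \<in> S" if "x \<in> S" for x using diff[OF 0 that] by simp
  have add: "x + y \<in> S" if "x \<in> S" "y \<in> S" for x y using diff[OF that(1) minus[OF that(2)]] by simp
  have mult: "m * x \<in> S" if "x \<in> S" for m x
  proof (induction m rule: int_induct[where k = 0])
    case (step1 i)
    then show ?case using add[OF step1(2) that] by (simp add: algebra_simps)
  next
    case (step2 i)
    then show ?case using diff[OF step2(2) that] by (simp add: algebra_simps)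
  qed (use 0 in simp)
  define i where "i = (LEAST i. p ^ i \<in> S)"
  have i: "p ^ i \<in> S" unfolding i_def using assms(2) by (rule LeastI)
  have "p ^ i dvd x" if "x \<in> S" for x
  proof -
    obtain r s where "r * x + s * p ^ n = gcd x (p ^ n)" using bezout_int by blast
    then have g: "gcd x (p ^ n) \<in> S" using mult add that assms(2) by metis
    have "gcd x (p ^ n) dvd p ^ n" by simp
    then obtain m where "normalize (gcd x (p ^ n)) = p ^ m"
      using divides_primepow[OF assms(1)] by metis
    then have m: "gcd x (p ^ n) = p ^ m" by simp
    then have "i \<le> m" using g unfolding i_def by (simp add: Least_le)
    then have "p ^ i dvd p ^ m" by (simp add: le_imp_power_dvd)
    then show ?thesis by (metis m dvd_trans gcd_dvd1)
  qed
  moreover have "x \<in> S" if "p ^ i dvd x" for x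
    using mult[OF i] that by (metis dvd_def mult.commute)
  moreover have "i \<le> n" unfolding i_def using assms(2) by (rule Least_le)
  ultimately show ?thesis using that by blast
qed

text \<open>Each coordinate axis meets \<open>K\<close> in a subgroup of the integers containing a
  power of \<open>p\<close>, and the shears of the three axis generators give the inequalities. The
  exponents found describe the largest box inside \<open>K\<close>, which need not be all of
  \<open>K\<close>.\<close>

lemma adm_core:
  fixes p :: int
  assumes p: "Factorial_Ring.prime p" and K: "adm p a b c K" and "a \<le> b" "b \<le> c"
  obtains i j k where "canonical a b c i j k" "\<And>x. (x, 0, 0) \<in> K \<longleftrightarrow> p ^ i dvd x"
    "\<And>y. (0, y, 0) \<in> K \<longleftrightarrow> p ^ j dvd y" "\<And>z. (0, 0, z) \<in> K \<longleftrightarrow> p ^ k dvd z"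
proof -
  have diff: "(x - x', y - y', z - z') \<in> K" if "(x, y, z) \<in> K" "(x', y', z') \<in> K" for x y z x' y' z'
    using adm_diff[OF K that] by (simp only: diff_Pair)
  have L: "(p ^ a, 0, 0) \<in> K" "(0, p ^ b, 0) \<in> K" "(0, 0, p ^ c) \<in> K"
    using adm_lattice[OF K] by auto
  obtain i where i: "i \<le> a" "\<And>x. (x, 0, 0) \<in> K \<longleftrightarrow> p ^ i dvd x"
  proof (rule prime_power_subgroup[OF p, of a "{x. (x, 0, 0) \<in> K}"])
    show "p ^ a \<in> {x. (x, 0, 0) \<in> K}" using L by simp
    show "x - y \<in> {x. (x, 0, 0) \<in> K}" if "x \<in> {x. (x, 0, 0) \<in> K}" "y \<in> {x. (x, 0, 0) \<in> K}" for x y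
      using that diff[of x 0 0 y 0 0] by simp
  qed (use that in auto)
  obtain j where j: "j \<le> b" "\<And>x. (0, x, 0) \<in> K \<longleftrightarrow> p ^ j dvd x"
  proof (rule prime_power_subgroup[OF p, of b "{x. (0, x, 0) \<in> K}"])
    show "p ^ b \<in> {x. (0, x, 0) \<in> K}" using L by simp
    show "x - y \<in> {x. (0, x, 0) \<in> K}" if "x \<in> {x. (0, x, 0) \<in> K}" "y \<in> {x. (0, x, 0) \<in> K}" for x y
      using that diff[of 0 x 0 0 y 0] by simp
  qed (use that in auto)
  obtain k where k: "k \<le> c" "\<And>x. (0, 0, x) \<in> K \<longleftrightarrow> p ^ k dvd x"
  proof (rule prime_power_subgroup[OF p, of c "{x. (0, 0, x) \<in> K}"])
    show "p ^ c \<in> {x. (0, 0, x) \<in> K}" using L by simp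
    show "x - y \<in> {x. (0, 0, x) \<in> K}" if "x \<in> {x. (0, 0, x) \<in> K}" "y \<in> {x. (0, 0, x) \<in> K}" for x y
      using that diff[of 0 0 x 0 0 y] by simp
  qed (use that in auto)
  have e: "(p ^ i, 0, 0) \<in> K" "(0, p ^ j, 0) \<in> K" "(0, 0, p ^ k) \<in> K" using i j k by auto
  have "(p ^ j, 0, 0) \<in> K" "(0, p ^ k, 0) \<in> K" "(0, p ^ (b - a) * p ^ i, 0) \<in> K"
      "(0, 0, p ^ (c - b) * p ^ j) \<in> K"
    using adm_shear(1)[OF K e(2)] adm_shear(3)[OF K e(3)] adm_shear(4)[OF K e(1)] adm_shear(6)[OF K e(2)] by auto
  then have "canonical a b c i j k"
    unfolding canonical_def i(2) j(2) k(2) power_add[symmetric]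
    using i(1) j(1) k(1) p by (auto simp: prime_power_dvd_iff)
  then show ?thesis using that i j k by blast
qed

lemma adm_coordinates:
  assumes "adm p a b c K" "(x, 0, 0) \<in> K" "(0, y, 0) \<in> K" "(0, 0, z) \<in> K"
  shows "(x, y, z) \<in> K"
  using adm_add[OF assms(1) adm_add[OF assms(1-3)] assms(4)] by simp

text \<open>For odd \<open>p\<close> the projections themselves are operations, so \<open>K\<close>
  is the sum of its intersections with the axes.\<close>

lemma adm_odd_iff:
  fixes p :: int
  assumes p: "Factorial_Ring.prime p" "p \<noteq> 2" and "a \<le> b" "b \<le> c"
  shows "adm p a b c K \<longleftrightarrow> (\<exists>i j k. canonical a b c i j k \<and> K = box p i j k)"
proof
  assume K: "adm p a b c K"
  obtain i j k where can: "canonical a b c i j k" and i: "\<And>x. (x, 0, 0) \<in> K \<longleftrightarrow> p ^ i dvd x"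
    and j: "\<And>y. (0, y, 0) \<in> K \<longleftrightarrow> p ^ j dvd y" and k: "\<And>z. (0, 0, z) \<in> K \<longleftrightarrow> p ^ k dvd z"
    using adm_core[OF p(1) K assms(3,4)] by metis
  have "(x, y, z) \<in> K \<longleftrightarrow> (x, y, z) \<in> box p i j k" for x y z
    using adm_diag[OF K, of x y z] adm_coordinates[OF K, of x y z] p(2) by (auto simp: i j k)
  then have "K = box p i j k" by auto
  with can show "\<exists>i j k. canonical a b c i j k \<and> K = box p i j k" by blast
qed (use assms adm_box in blast)

section \<open>Admissible subgroups for the prime 2\<close>

text \<open>A box together with its translate by \<open>w\<close>. Taking \<open>w\<close> zero
  gives the plain box, so one format covers every admissible subgroup for
  \<open>p = 2\<close>.\<close>

definition glued :: "nat \<Rightarrow> nat \<Rightarrow> nat \<Rightarrow> int \<times> int \<times> int \<Rightarrow> (int \<times> int \<times> int) set" where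
  "glued i j k w = {v. v \<in> box 2 i j k \<or> v - w \<in> box 2 i j k}"

lemma glued_zero [simp]: "glued i j k (0, 0, 0) = box 2 i j k"
  by (auto simp: glued_def)

text \<open>The doubled coordinates of \<open>w\<close> lie in the box, hence so does
  \<open>w + w\<close>, and the two cosets form a group. Every operation sends both cosets into the
  box itself.\<close>

lemma adm_glued:
  assumes "canonical a b c i j k" "a \<le> b" "b \<le> c"
    and w: "\<And>f. f \<in> ops 2 a b c \<Longrightarrow> f w \<in> box 2 i j k"
  shows "adm 2 a b c (glued i j k w)"
proof -
  let ?B = "box 2 i j k"
  obtain x y z where xyz: "w = (x, y, z)" by (cases w)
  have "(2 * x, 0, 0) \<in> ?B" "(0, 2 * y, 0) \<in> ?B" "(0, 0, 2 * z) \<in> ?B"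
    using w[of "\<lambda>(x, y, z). (2 * x, 0, 0)"] w[of "\<lambda>(x, y, z). (0, 2 * y, 0)"]
      w[of "\<lambda>(x, y, z). (0, 0, 2 * z)"] by (simp_all add: ops_def xyz)
  then have ww: "w + w \<in> ?B" by (simp add: xyz)
  have "u - v \<in> glued i j k w" if u: "u \<in> glued i j k w" and v: "v \<in> glued i j k w" for u v
  proof -
    consider "u - v \<in> ?B" | "u \<in> ?B" "v - w \<in> ?B" | "u - w \<in> ?B" "v \<in> ?B"
      using u v box_diff[of u 2 i j k v] box_diff[of "u - w" 2 i j k "v - w"]
      by (auto simp: glued_def)
    then show ?thesis
    proof cases
      case 2
      \<comment> \<open>If only \<open>v\<close> lies in the translate, then \<open>u - v\<close>
        lies in the translate by \<open>- w\<close>, which is the same coset because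
        \<open>w + w\<close> is in the box.\<close>
      have "u - (v - w) - (w + w) \<in> ?B" using box_diff 2 ww by blast
      then show ?thesis by (simp add: glued_def algebra_simps)
    next
      case 3
      have "(u - w) - v \<in> ?B" using box_diff 3 by blast
      then show ?thesis by (simp add: glued_def algebra_simps)
    qed (simp add: glued_def)
  qed
  moreover have "f v \<in> glued i j k w" if f: "f \<in> ops 2 a b c" and v: "v \<in> glued i j k w" for f v
  proof (cases "v \<in> ?B")
    case True
    then show ?thesis using box_op[OF assms(1-3) f] by (simp add: glued_def)
  next
    case False
    then have "f (v - w) \<in> ?B" using v box_op[OF assms(1-3) f] by (simp add: glued_def)
    then have "f (v - w) + f w \<in> ?B" using w[OF f] by (rule box_add)
    then show ?thesis by (simp add: ops_diff[OF f] glued_def)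
  qed
  moreover have "box 2 a b c \<subseteq> glued i j k w"
    using adm_lattice[OF adm_box[OF assms(1-3)], of 2] by (auto simp: glued_def)
  ultimately show ?thesis by (simp add: adm_def)
qed

text \<open>Half of the generator \<open>2 ^ i\<close>. The generator 1 has no half; the value 0 at
  exponent 0 is a default, so half-steps are paired with a nonzero exponent.\<close>

definition half :: "nat \<Rightarrow> int" where
  "half i = (if i = 0 then 0 else 2 ^ (i - 1))"

lemma half_cases:
  assumes "2 ^ i dvd 2 * (x::int)"
  shows "2 ^ i dvd x \<or> i \<noteq> 0 \<and> 2 ^ i dvd x - half i"
proof (cases i)
  case (Suc n)
  then obtain m where m: "x = 2 ^ n * m" using assms by (auto elim: dvdE)
  show ?thesis
  proof (cases "even m")
    case True
    then show ?thesis by (auto simp: Suc m elim!: evenE)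
  next
    case False
    then show ?thesis by (auto simp: Suc m half_def algebra_simps elim!: oddE)
  qed
qed simp

text \<open>Modulo the largest box inside \<open>K\<close> every element has coordinates that are zero or half a step.
  A single half-step would enlarge the box, and the shears between the first two coordinates
  prevent these from having half-steps at the same time.\<close>

lemma adm_two_cases:
  assumes K: "adm 2 a b c K" and ab: "a = 0 \<or> b = a + 1" "a \<le> b" "b \<le> c"
  obtains i j k w where "canonical a b c i j k" "K = glued i j k w"
    "w = (0, 0, 0) \<or>
     w = (half i, 0, half k) \<and> i \<noteq> 0 \<and> i < k \<and> j = i \<and> k < i + (c - a) \<or>
     w = (0, half j, half k) \<and> i < j \<and> j < k \<and> k < j + (c - b)"
proof -
  have two: "Factorial_Ring.prime (2::int)" by simp
  obtain i j k where can: "canonical a b c i j k" and i: "\<And>x. (x, 0, 0) \<in> K \<longleftrightarrow> 2 ^ i dvd x"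
    and j: "\<And>y. (0, y, 0) \<in> K \<longleftrightarrow> 2 ^ j dvd y" and k: "\<And>z. (0, 0, z) \<in> K \<longleftrightarrow> 2 ^ k dvd z"
    using adm_core[OF two K ab(2,3)] by metis
  let ?B = "box 2 i j k"
  have BK: "?B \<subseteq> K" using adm_coordinates[OF K] by (auto simp: box_def i j k)
  have half_dvd: "2 ^ m dvd 2 ^ n * half l \<longleftrightarrow> m < n + l" if "l \<noteq> 0" for m n l
  proof -
    have "2 ^ n * half l = 2 ^ (n + l - 1)" using that by (simp add: half_def power_add[symmetric])
    then show ?thesis using that by (auto simp: dvd_power_iff)
  qed
  have half_dvd0: "2 ^ m dvd half l \<longleftrightarrow> m < l" if "l \<noteq> 0" for m l
    using half_dvd[OF that, of m 0] by simp
  have can': "i \<le> a" "i \<le> j" using can by (auto simp: canonical_def)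
  \<comment> \<open>Here \<open>i \<noteq> 0\<close> excludes \<open>a = 0\<close>, so
    \<open>b = a + 1\<close> and the shear into the second coordinate gives
    \<open>j < i + 1\<close>. This is incompatible with the bound \<open>i < j\<close> that a
    half-step in the second coordinate forces.\<close>
  have h1: "j \<le> i \<and> k < i + (c - a)" if "(half i, y, z) \<in> K" "i \<noteq> 0" for y z
    using adm_shear(4,5)[OF K that(1)] half_dvd[OF that(2)] ab(1) can'(1) that(2)
    by (auto simp: j k)
  have h2: "i < j \<and> k < j + (c - b)" if "(x, half j, z) \<in> K" "j \<noteq> 0" for x z
    using adm_shear(1,6)[OF K that(1)] half_dvd[OF that(2)] half_dvd0[OF that(2)]
    by (auto simp: i k)
  have h3: "i < k \<and> j < k" if "(x, y, half k) \<in> K" "k \<noteq> 0" for x y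
    using adm_shear(2,3)[OF K that(1)] half_dvd0[OF that(2)] by (auto simp: i j)
  have exceptional: "v - (half i, 0, half k) \<in> ?B \<and> (half i, 0, half k) \<in> K
      \<and> i \<noteq> 0 \<and> i < k \<and> j = i \<and> k < i + (c - a) \<or>
    v - (0, half j, half k) \<in> ?B \<and> (0, half j, half k) \<in> K \<and> i < j \<and> j < k \<and> k < j + (c - b)"
    if v: "v \<in> K" "v \<notin> ?B" for v
  proof -
    obtain x y z where xyz: "v = (x, y, z)" by (cases v)
    have "2 ^ i dvd 2 * x" "2 ^ j dvd 2 * y" "2 ^ k dvd 2 * z"
      using adm_diag[OF K v(1)[unfolded xyz]] by (auto simp: i j k)
    \<comment> \<open>Rounding each coordinate to zero or a half-step gives a representative of the
      coset of \<open>v\<close> modulo the box.\<close>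
    then obtain e1 e2 e3 where e: "2 ^ i dvd x - e1" "2 ^ j dvd y - e2" "2 ^ k dvd z - e3"
      "e1 = 0 \<or> i \<noteq> 0 \<and> e1 = half i" "e2 = 0 \<or> j \<noteq> 0 \<and> e2 = half j" "e3 = 0 \<or> k \<noteq> 0 \<and> e3 = half k"
      using half_cases[of i x] half_cases[of j y] half_cases[of k z] by (metis diff_zero)
    have vB: "v - (e1, e2, e3) \<in> ?B" using e by (simp add: xyz)
    have wK: "(e1, e2, e3) \<in> K" using adm_diff[OF K v(1), of "v - (e1, e2, e3)"] vB BK by auto
    have wB: "(e1, e2, e3) \<notin> ?B" using v(2) box_add[OF vB, of "(e1, e2, e3)"] by (metis diff_add_cancel)
    show ?thesis
    proof (cases "e1 = 0")
      case True
      have "e2 \<noteq> 0" "e3 \<noteq> 0" using wK wB True by (auto simp: j k)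
      then have "j \<noteq> 0" "e2 = half j" "k \<noteq> 0" "e3 = half k" using e(5,6) by auto
      then show ?thesis using wK vB h2[of 0 "half k"] h3[of 0 "half j"] True by simp
    next
      case False
      then have e1: "i \<noteq> 0" "e1 = half i" using e(4) by auto
      then have h: "j \<le> i" "k < i + (c - a)" using h1[of e2 e3] wK by auto
      then have e2: "e2 = 0" using e(5) h2[of e1 e3] wK by auto
      have "e3 \<noteq> 0" using wK wB e2 by (auto simp: i)
      then have "k \<noteq> 0" "e3 = half k" using e(6) by auto
      then show ?thesis using wK vB h3[of "half i" 0] h e1 e2 can'(2) by simp
    qed
  qed
  show ?thesis
  proof (cases "K \<subseteq> ?B")
    case True
    then show ?thesis using that[OF can, of "(0, 0, 0)"] BK by auto
  next
    case False
    then obtain v where v: "v \<in> K" "v \<notin> ?B" by blast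
    have glue: "K = glued i j k w" if "w \<in> K" "\<And>u. u \<in> K \<Longrightarrow> u \<notin> ?B \<Longrightarrow> u - w \<in> ?B" for w
    proof
      show "K \<subseteq> glued i j k w" using that by (auto simp: glued_def)
      show "glued i j k w \<subseteq> K"
      proof
        fix u assume "u \<in> glued i j k w"
        then have "u \<in> K \<or> u - w \<in> K" using BK by (auto simp: glued_def)
        then show "u \<in> K" using adm_add[OF K _ that(1), of "u - w"] by auto
      qed
    qed
    \<comment> \<open>The two kinds of half-step vector exclude each other, as one needs
      \<open>j = i\<close> and the other \<open>i < j\<close>. So all elements of \<open>K\<close>
      outside the box share one representative.\<close>
    from exceptional[OF v] show ?thesis
    proof (elim disjE conjE)
      assume A: "(half i, 0, half k) \<in> K" "i \<noteq> 0" "i < k" "j = i" "k < i + (c - a)"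
      have "K = glued i j k (half i, 0, half k)"
        by (rule glue[OF A(1)]) (use exceptional A in blast)
      then show ?thesis using that[OF can] A by blast
    next
      assume A: "(0, half j, half k) \<in> K" "i < j" "j < k" "k < j + (c - b)"
      have "K = glued i j k (0, half j, half k)"
        by (rule glue[OF A(1)]) (use exceptional A in blast)
      then show ?thesis using that[OF can] A by blast
    qed
  qed
qed


section \<open>Matching the two finite posets\<close>

text \<open>Agreement of the inclusions entails agreement of the equalities, so passing to the
  member with the same index is well defined and injective.\<close>

lemma lattice_iso_images:
  assumes "\<And>s t. s \<in> P \<Longrightarrow> t \<in> P \<Longrightarrow> m s \<subseteq> m t \<longleftrightarrow> m' s \<subseteq> m' t"
  shows "lattice_iso (m ` P) (m' ` P)"
proof -
  define g where "g A = m' (inv_into P m A)" for A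
  have eq: "m s = m t \<longleftrightarrow> m' s = m' t" if "s \<in> P" "t \<in> P" for s t
    using assms[OF that] assms[OF that(2,1)] by blast
  have g: "g (m s) = m' s" if "s \<in> P" for s
    unfolding g_def using eq[of "inv_into P m (m s)" s] that
    by (metis f_inv_into_f imageI inv_into_into)
  have "bij_betw g (m ` P) (m' ` P)"
    unfolding bij_betw_def inj_on_def using eq by (auto simp: g image_image)
  then show ?thesis
    unfolding lattice_iso_def using assms by (auto simp: g intro!: exI[of _ g])
qed

text \<open>An explicit matching of the twelve boxes on either side. Paired triples have the same
  sum, so paired boxes have the same index in the integer lattice.\<close>

definition core_pairs :: "((nat \<times> nat \<times> nat) \<times> (nat \<times> nat \<times> nat)) set" where
  "core_pairs =
    {((0, 2, 5), (1, 2, 4)), ((0, 2, 4), (1, 2, 3)), ((0, 2, 3), (1, 1, 3)),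
     ((0, 2, 2), (0, 1, 3)), ((0, 1, 4), (1, 2, 2)), ((0, 1, 3), (1, 1, 2)),
     ((0, 1, 2), (0, 1, 2)), ((0, 1, 1), (0, 0, 2)), ((0, 0, 3), (1, 1, 1)),
     ((0, 0, 2), (0, 1, 1)), ((0, 0, 1), (0, 0, 1)), ((0, 0, 0), (0, 0, 0))}"

lemma canonical_025: "canonical 0 2 5 i j k \<longleftrightarrow> (i, j, k) \<in> fst ` core_pairs"
proof -
  have "canonical 0 2 5 i j k \<longleftrightarrow> i = 0 \<and> (j = 0 \<or> j = 1 \<or> j = 2) \<and> (k = j \<or> k = j + 1 \<or> k = j + 2 \<or> k = j + 3)"
    unfolding canonical_def by arith
  then have "canonical 0 2 5 i j k \<Longrightarrow> (i, j, k) \<in> fst ` core_pairs"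
    unfolding core_pairs_def by (simp only:) (elim conjE disjE, simp_all)
  moreover have "(i, j, k) \<in> fst ` core_pairs \<Longrightarrow> canonical 0 2 5 i j k"
    by (auto simp: core_pairs_def canonical_def)
  ultimately show ?thesis by blast
qed

lemma canonical_124: "canonical 1 2 4 i j k \<longleftrightarrow> (i, j, k) \<in> snd ` core_pairs"
proof -
  have "canonical 1 2 4 i j k \<longleftrightarrow>
      (i = 0 \<or> i = 1) \<and> (j = i \<or> j = i + 1) \<and> (k = j \<or> k = j + 1 \<or> k = j + 2)"
    unfolding canonical_def by arith
  then have "canonical 1 2 4 i j k \<Longrightarrow> (i, j, k) \<in> snd ` core_pairs"
    unfolding core_pairs_def by (simp only:) (elim conjE disjE, simp_all)
  moreover have "(i, j, k) \<in> snd ` core_pairs \<Longrightarrow> canonical 1 2 4 i j k"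
    by (auto simp: core_pairs_def canonical_def)
  ultimately show ?thesis by blast
qed

lemma lattice_iso_adm_odd:
  fixes p :: int
  assumes p: "Factorial_Ring.prime p" "p \<noteq> 2"
  shows "lattice_iso {K. adm p 0 2 5 K} {K. adm p 1 2 4 K}"
proof -
  define B where "B = (\<lambda>(i, j, k). box p i j k)"
  have im: "{K. \<exists>i j k. (i, j, k) \<in> S \<and> K = box p i j k} = B ` S" for S
    by (force simp: B_def)
  have "{K. adm p 0 2 5 K} = B ` fst ` core_pairs"
    unfolding im[symmetric] canonical_025[symmetric] by (simp add: adm_odd_iff[OF p])
  moreover have "{K. adm p 1 2 4 K} = B ` snd ` core_pairs"
    unfolding im[symmetric] canonical_124[symmetric] by (simp add: adm_odd_iff[OF p])
  moreover have "B (fst s) \<subseteq> B (fst t) \<longleftrightarrow> B (snd s) \<subseteq> B (snd t)"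
    if "s \<in> core_pairs" "t \<in> core_pairs" for s t
  proof -
    \<comment> \<open>By \<open>box_subset_iff\<close> this only compares exponents, in 144 cases
      that do not depend on \<open>p\<close>.\<close>
    have "\<forall>s\<in>core_pairs. \<forall>t\<in>core_pairs. B (fst s) \<subseteq> B (fst t) \<longleftrightarrow> B (snd s) \<subseteq> B (snd t)"
      by (simp add: core_pairs_def B_def box_subset_iff[OF p(1)])
    with that show ?thesis by blast
  qed
  ultimately show ?thesis
    using lattice_iso_images[of core_pairs "B \<circ> fst" "B \<circ> snd"] by (simp add: image_comp)
qed

text \<open>The four additional pairs sit over pairs of \<open>core_pairs\<close>. The half-steps
  are in the second and third coordinates, except over the right-hand boxes \<open>(1, 1, 3)\<close>
  and \<open>(1, 1, 2)\<close>, where they are in the first and third.\<close>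

definition glued_pairs ::
    "((nat \<times> nat \<times> nat \<times> int \<times> int \<times> int) \<times> (nat \<times> nat \<times> nat \<times> int \<times> int \<times> int)) set" where
  "glued_pairs = (\<lambda>((i, j, k), (i', j', k')). ((i, j, k, (0, 0, 0)), (i', j', k', (0, 0, 0)))) ` core_pairs \<union>
    {((0, 2, 4, (0, 2, 8)), (1, 2, 3, (0, 2, 4))), ((0, 2, 3, (0, 2, 4)), (1, 1, 3, (1, 0, 4))),
     ((0, 1, 3, (0, 1, 4)), (1, 1, 2, (1, 0, 2))), ((0, 1, 2, (0, 1, 2)), (0, 1, 2, (0, 1, 2)))}"


lemma core_pairs_glued:
  "((i, j, k), (i', j', k')) \<in> core_pairs \<Longrightarrow> ((i, j, k, (0, 0, 0)), (i', j', k', (0, 0, 0))) \<in> glued_pairs"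
  unfolding glued_pairs_def by (rule UnI1, rule rev_image_eqI, assumption, simp)

lemma glued_pairs_extra:
  "((0, 2, 4, (0, 2, 8)), (1, 2, 3, (0, 2, 4))) \<in> glued_pairs"
  "((0, 2, 3, (0, 2, 4)), (1, 1, 3, (1, 0, 4))) \<in> glued_pairs"
  "((0, 1, 3, (0, 1, 4)), (1, 1, 2, (1, 0, 2))) \<in> glued_pairs"
  "((0, 1, 2, (0, 1, 2)), (0, 1, 2, (0, 1, 2))) \<in> glued_pairs"
  unfolding glued_pairs_def by (rule UnI2, simp)+

definition glued_leq where
  "glued_leq s t = (case s of (i, j, k, w) \<Rightarrow> case t of (i', j', k', w') \<Rightarrow>
    {(2 ^ i, 0, 0), (0, 2 ^ j, 0), (0, 0, 2 ^ k), w} \<subseteq> glued i' j' k' w')"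

text \<open>The three axis generators and \<open>w\<close> generate the left side, and the right
  side is closed under addition and integer multiples because it is admissible. Inclusion becomes a
  finite test.\<close>

lemma glued_subset_iff:
  assumes "adm 2 a b c (glued i' j' k' w')"
  shows "glued i j k w \<subseteq> glued i' j' k' w' \<longleftrightarrow> glued_leq (i, j, k, w) (i', j', k', w')"
proof
  assume L: "glued i j k w \<subseteq> glued i' j' k' w'"
  have "{(2 ^ i, 0, 0), (0, 2 ^ j, 0), (0, 0, 2 ^ k), w} \<subseteq> glued i j k w"
    by (simp add: glued_def) (simp add: zero_prod_def)
  with L show "glued_leq (i, j, k, w) (i', j', k', w')" by (auto simp: glued_leq_def)
next
  assume R: "glued_leq (i, j, k, w) (i', j', k', w')"
  then have gens: "(2 ^ i, 0, 0) \<in> glued i' j' k' w'" "(0, 2 ^ j, 0) \<in> glued i' j' k' w'"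
    "(0, 0, 2 ^ k) \<in> glued i' j' k' w'" unfolding glued_leq_def by simp_all
  have B: "box 2 i j k \<subseteq> glued i' j' k' w'"
  proof
    fix v assume "v \<in> box 2 i j k"
    moreover obtain x y z where v: "v = (x, y, z)" by (cases v)
    ultimately have "2 ^ i dvd x" "2 ^ j dvd y" "2 ^ k dvd z" by simp_all
    then obtain l m n where xyz: "x = 2 ^ i * l" "y = 2 ^ j * m" "z = 2 ^ k * n"
      by (elim dvdE)
    have "(l * 2 ^ i, l * 0, l * 0) \<in> glued i' j' k' w'" "(m * 0, m * 2 ^ j, m * 0) \<in> glued i' j' k' w'"
      "(n * 0, n * 0, n * 2 ^ k) \<in> glued i' j' k' w'"
      by (intro adm_smult[OF assms] gens)+
    then show "v \<in> glued i' j' k' w'"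
      unfolding v xyz by (simp add: adm_coordinates[OF assms] mult.commute)
  qed
  show "glued i j k w \<subseteq> glued i' j' k' w'"
  proof
    fix v assume "v \<in> glued i j k w"
    then have "v \<in> glued i' j' k' w' \<or> v - w \<in> glued i' j' k' w'"
      using B by (auto simp: glued_def[of i j k])
    moreover have "w \<in> glued i' j' k' w'" using R unfolding glued_leq_def by simp
    ultimately show "v \<in> glued i' j' k' w'"
      using adm_add[OF assms, of "v - w" w] by auto
  qed
qed

lemma adm_two_025: "{K. adm 2 0 2 5 K} = (\<lambda>(i, j, k, w). glued i j k w) ` fst ` glued_pairs"
  (is "_ = ?R")
proof
  have c: "adm 2 0 2 5 (glued i j k (0, 0, 0))" if "((i, j, k), t) \<in> core_pairs" for i j k t
    using adm_box[of 0 2 5 i j k 2] canonical_025[of i j k] that by force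
  have "adm 2 0 2 5 (glued 0 2 4 (0, 2, 8))" "adm 2 0 2 5 (glued 0 2 3 (0, 2, 4))"
    "adm 2 0 2 5 (glued 0 1 3 (0, 1, 4))" "adm 2 0 2 5 (glued 0 1 2 (0, 1, 2))"
    by (rule adm_glued; auto simp: canonical_def ops_def)+
  with c show "?R \<subseteq> {K. adm 2 0 2 5 K}"
    by (auto simp: glued_pairs_def)
  show "{K. adm 2 0 2 5 K} \<subseteq> ?R"
  proof clarify
    fix K assume K: "adm 2 0 2 5 K"
    obtain i j k w where can: "canonical 0 2 5 i j k" and Kw: "K = glued i j k w"
      and w: "w = (0, 0, 0) \<or>
       w = (half i, 0, half k) \<and> i \<noteq> 0 \<and> i < k \<and> j = i \<and> k < i + (5 - 0) \<or>
       w = (0, half j, half k) \<and> i < j \<and> j < k \<and> k < j + (5 - 2)"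
      by (rule adm_two_cases[OF K]) auto
    obtain t where t: "((i, j, k), t) \<in> core_pairs" using can canonical_025 by force
    have "(i, j, k, w) \<in> fst ` glued_pairs" using w
    proof (elim disjE conjE)
      assume "w = (0, 0, 0)"
      then show ?thesis using t core_pairs_glued by (cases t) force
    next
      \<comment> \<open>With \<open>a = 0\<close> the first exponent is 0, so there is no half-step
        in the first coordinate.\<close>
      assume "i \<noteq> 0"
      then show ?thesis using can by (simp add: canonical_def)
    next
      assume h: "w = (0, half j, half k)" "i < j" "j < k" "k < j + (5 - 2)"
      with can have "i = 0 \<and> (j = 1 \<and> (k = 2 \<or> k = 3) \<or> j = 2 \<and> (k = 3 \<or> k = 4))"
        unfolding canonical_def by arith
      then show ?thesis
        using glued_pairs_extra[THEN imageI, of fst]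
        by (elim conjE disjE) (simp_all add: h(1) half_def)
    qed
    then show "K \<in> ?R" unfolding Kw by force
  qed
qed

lemma adm_two_124: "{K. adm 2 1 2 4 K} = (\<lambda>(i, j, k, w). glued i j k w) ` snd ` glued_pairs"
  (is "_ = ?R")
proof
  have c: "adm 2 1 2 4 (glued i j k (0, 0, 0))" if "(t, (i, j, k)) \<in> core_pairs" for i j k t
    using adm_box[of 1 2 4 i j k 2] canonical_124[of i j k] that by force
  have "adm 2 1 2 4 (glued 1 2 3 (0, 2, 4))" "adm 2 1 2 4 (glued 1 1 3 (1, 0, 4))"
    "adm 2 1 2 4 (glued 1 1 2 (1, 0, 2))" "adm 2 1 2 4 (glued 0 1 2 (0, 1, 2))"
    by (rule adm_glued; auto simp: canonical_def ops_def)+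
  with c show "?R \<subseteq> {K. adm 2 1 2 4 K}"
    by (auto simp: glued_pairs_def)
  show "{K. adm 2 1 2 4 K} \<subseteq> ?R"
  proof clarify
    fix K assume K: "adm 2 1 2 4 K"
    obtain i j k w where can: "canonical 1 2 4 i j k" and Kw: "K = glued i j k w"
      and w: "w = (0, 0, 0) \<or>
       w = (half i, 0, half k) \<and> i \<noteq> 0 \<and> i < k \<and> j = i \<and> k < i + (4 - 1) \<or>
       w = (0, half j, half k) \<and> i < j \<and> j < k \<and> k < j + (4 - 2)"
      by (rule adm_two_cases[OF K]) auto
    obtain t where t: "(t, (i, j, k)) \<in> core_pairs" using can canonical_124 by force
    have "(i, j, k, w) \<in> snd ` glued_pairs" using w
    proof (elim disjE conjE)
      assume "w = (0, 0, 0)"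
      then show ?thesis using t core_pairs_glued by (cases t) force
    next
      assume h: "w = (half i, 0, half k)" "i \<noteq> 0" "i < k" "j = i" "k < i + (4 - 1)"
      with can have "i = 1 \<and> j = 1 \<and> (k = 2 \<or> k = 3)"
        unfolding canonical_def by arith
      then show ?thesis
        using glued_pairs_extra[THEN imageI, of snd]
        by (elim conjE disjE) (simp_all add: h(1) half_def)
    next
      assume h: "w = (0, half j, half k)" "i < j" "j < k" "k < j + (4 - 2)"
      with can have "i = 0 \<and> j = 1 \<and> k = 2 \<or> i = 1 \<and> j = 2 \<and> k = 3"
        unfolding canonical_def by arith
      then show ?thesis
        using glued_pairs_extra[THEN imageI, of snd]
        by (elim conjE disjE) (simp_all add: h(1) half_def)
    qed
    then show "K \<in> ?R" unfolding Kw by force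
  qed
qed

text \<open>Expresses the test by divisibilities of numerals, which simplification can decide for
  all 256 pairs of entries of \<open>glued_pairs\<close>.\<close>

lemma glued_leq_iff_dvd:
  "glued_leq (i, j, k, (x, y, z)) (i', j', k', (u, v, w)) \<longleftrightarrow>
    (let M = (\<lambda>x y z. 2 ^ i' dvd x \<and> 2 ^ j' dvd y \<and> 2 ^ k' dvd z \<or>
      2 ^ i' dvd x - u \<and> 2 ^ j' dvd y - v \<and> 2 ^ k' dvd z - w)
     in M (2 ^ i) 0 0 \<and> M 0 (2 ^ j) 0 \<and> M 0 0 (2 ^ k) \<and> M x y z)"
proof -
  have "(x, y, z) \<in> glued i' j' k' (u, v, w) \<longleftrightarrow> 2 ^ i' dvd x \<and> 2 ^ j' dvd y \<and> 2 ^ k' dvd z \<or>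
     2 ^ i' dvd x - u \<and> 2 ^ j' dvd y - v \<and> 2 ^ k' dvd z - w" for x y z
    by (simp add: glued_def)
  then show ?thesis
    unfolding glued_leq_def Let_def by simp
qed

lemma glued_leq_pairs:
  "\<forall>s\<in>glued_pairs. \<forall>t\<in>glued_pairs. glued_leq (fst s) (fst t) \<longleftrightarrow> glued_leq (snd s) (snd t)"
  by (simp add: glued_pairs_def core_pairs_def glued_leq_iff_dvd Let_def)

lemma lattice_iso_adm_two: "lattice_iso {K. adm 2 0 2 5 K} {K. adm 2 1 2 4 K}"
proof -
  define G where "G = (\<lambda>(i, j, k, w). glued i j k w)"
  have "G s \<subseteq> G t \<longleftrightarrow> glued_leq s t" if "adm 2 a b c (G t)" for a b c s t
    using that by (cases s; cases t) (simp add: G_def glued_subset_iff)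
  moreover have "adm 2 0 2 5 (G (fst t))" "adm 2 1 2 4 (G (snd t))" if "t \<in> glued_pairs" for t
    using that adm_two_025 adm_two_124 by (auto simp: G_def)
  ultimately have "G (fst s) \<subseteq> G (fst t) \<longleftrightarrow> G (snd s) \<subseteq> G (snd t)"
    if "s \<in> glued_pairs" "t \<in> glued_pairs" for s t
    using glued_leq_pairs that by metis
  then show ?thesis
    using lattice_iso_images[of glued_pairs "G \<circ> fst" "G \<circ> snd"]
    unfolding adm_two_025 adm_two_124 by (simp add: image_comp G_def)
qed

section \<open>Characteristic subgroups as lattice subgroups\<close>

definition prod_group :: "nat \<Rightarrow> nat \<Rightarrow> nat \<Rightarrow> nat \<Rightarrow> (int \<times> int \<times> int) monoid" where
  "prod_group p a b c =
    integer_mod_group (p ^ a) \<times>\<times> (integer_mod_group (p ^ b) \<times>\<times> integer_mod_group (p ^ c))"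

definition red :: "int \<Rightarrow> nat \<Rightarrow> nat \<Rightarrow> nat \<Rightarrow> int \<times> int \<times> int \<Rightarrow> int \<times> int \<times> int" where
  "red p a b c = (\<lambda>(x, y, z). (x mod p ^ a, y mod p ^ b, z mod p ^ c))"

definition smul :: "int \<Rightarrow> int \<times> int \<times> int \<Rightarrow> int \<times> int \<times> int" where
  "smul n = (\<lambda>(x, y, z). (n * x, n * y, n * z))"

lemma smul_simps [simp]: "smul n (x, y, z) = (n * x, n * y, n * z)"
  by (simp add: smul_def)

lemma ops_smul: "f \<in> ops p a b c \<Longrightarrow> f (smul n v) = smul n (f v)"
  by (cases v) (auto simp: ops_def Let_def)

lemma box_smul: "v \<in> box p i j k \<Longrightarrow> smul n v \<in> box p i j k"
  by (cases v) auto

section \<open>The product group as a quotient of the integer lattice, and its elementary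
  automorphisms\<close>

locale prime_power_product =
  fixes p a b c :: nat
  assumes p: "Factorial_Ring.prime p" and abc: "a < b" "b < c"
begin

abbreviation "G \<equiv> prod_group p a b c"
abbreviation "r \<equiv> red (int p) a b c"
abbreviation "L \<equiv> box (int p) a b c"

lemma group_G: "group G"
  unfolding prod_group_def by (intro DirProd_group group_integer_mod_group)

lemma p_pos: "0 < p"
  using p by (simp add: prime_gt_0_nat)

lemma mem_carrier: "v \<in> carrier G \<longleftrightarrow> r v = v"
proof -
  obtain x y z where "v = (x, y, z)" by (cases v)
  then show ?thesis using p_pos
    by (auto simp: prod_group_def red_def carrier_integer_mod_group mod_eq_self_iff_div_eq_0 zdiv_eq_0_iff)
      (smt (verit) of_nat_0_less_iff zero_less_power)+
qed

lemma carrier_nonneg: "(x, y, z) \<in> carrier G \<Longrightarrow> 0 \<le> x \<and> 0 \<le> y \<and> 0 \<le> z"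
  using p_pos by (simp add: prod_group_def carrier_integer_mod_group)

lemma finite_carrier: "finite (carrier G)"
  using p_pos by (simp add: prod_group_def carrier_integer_mod_group)

lemma red_red [simp]: "r (r v) = r v"
  by (cases v) (simp add: red_def)

lemma red_carrier [simp]: "r v \<in> carrier G"
  by (simp add: mem_carrier)

lemma mult_G: "u \<otimes>\<^bsub>G\<^esub> v = r (u + v)"
  by (cases u; cases v) (simp add: prod_group_def red_def)

lemma one_G: "\<one>\<^bsub>G\<^esub> = (0, 0, 0)"
  by (simp add: prod_group_def)

lemma red_eq_iff: "r u = r v \<longleftrightarrow> u - v \<in> L"
  by (cases u; cases v) (simp add: red_def mod_eq_dvd_iff)

lemma red_zero: "r (0, 0, 0) = (0, 0, 0)"
  by (simp add: red_def)

lemma red_eq_zero_iff: "r v = (0, 0, 0) \<longleftrightarrow> v \<in> L"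
  using red_eq_iff[of v "(0, 0, 0)"] by (cases v) (simp add: red_zero)

lemma red_diff: "v - r v \<in> L"
  using red_eq_iff[of v "r v"] by simp

lemma red_add: "r (r u + r v) = r (u + v)"
  using box_add[OF red_diff[of u] red_diff[of v]] red_eq_iff[of "u + v" "r u + r v"]
  by (simp add: algebra_simps)

lemma inv_G: "inv\<^bsub>G\<^esub> (r v) = r (- v)"
  by (rule group.inv_equality[OF group_G]) (simp_all add: mult_G red_add one_G, simp add: red_def zero_prod_def)

text \<open>An additive map that preserves the box \<open>L\<close> descends to the quotient; a
  second one that inverts it modulo \<open>L\<close> makes the induced map bijective.\<close>

lemma additive_iso:
  assumes diff: "\<And>u v. g (u - v) = g u - g v" "\<And>u v. g' (u - v) = g' u - g' v"
    and L: "\<And>v. v \<in> L \<Longrightarrow> g v \<in> L" "\<And>v. v \<in> L \<Longrightarrow> g' v \<in> L"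
    and inv: "\<And>v. g' (g v) - v \<in> L" "\<And>v. g (g' v) - v \<in> L"
  shows "(\<lambda>v. r (g v)) \<in> iso G G"
proof -
  have cong: "r (g (r v)) = r (g v)" "r (g' (r v)) = r (g' v)" for v
    using L(1)[OF red_diff[of v]] L(2)[OF red_diff[of v]] red_eq_iff by (metis diff)+
  have add: "g (u + v) = g u + g v" for u v
    using diff(1)[of "u + v" v] by simp
  have "(\<lambda>v. r (g v)) \<in> hom G G"
    by (simp add: hom_def mult_G cong add red_add)
  moreover have "bij_betw (\<lambda>v. r (g v)) (carrier G) (carrier G)"
    using inv by (intro bij_betw_byWitness[where f' = "\<lambda>v. r (g' v)"])
      (auto simp: cong, auto simp: mem_carrier red_eq_iff[symmetric])
  ultimately show ?thesis by (simp add: iso_def)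
qed

lemma prime_power_odd: "p \<noteq> 2 \<Longrightarrow> odd (int p ^ c)"
  using p abc by (simp add: prime_odd_nat) (metis p primes_dvd_imp_eq two_is_prime_nat)

text \<open>Every operation satisfies \<open>f (f v) = smul e (f v)\<close> for a constant
  \<open>e\<close>, so composing identity plus \<open>s\<close> times \<open>f\<close> with identity
  plus \<open>m\<close> times \<open>f\<close> yields identity plus \<open>s + m + s * m * e\<close>
  times \<open>f\<close>. It suffices to choose \<open>m\<close> so that \<open>p ^ c\<close>, which
  annihilates the group, divides this coefficient.\<close>

lemma op_automorphism:
  assumes f: "f \<in> ops (int p) a b c"
  obtains s where "s = 1 \<or> s = - 1" "(\<lambda>v. r (v + smul s (f v))) \<in> iso G G"
proof -
  have "\<exists>e s m. (s = 1 \<or> s = - 1) \<and> (\<forall>v. f (f v) = smul e (f v)) \<and> int p ^ c dvd s + m + s * m * e"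
  proof (cases "\<forall>v. f (f v) = (0, 0, 0)")
    case True
    \<comment> \<open>Off-diagonal operations have square zero, so the inverse of identity plus
      \<open>f\<close> is identity minus \<open>f\<close>.\<close>
    then show ?thesis
      by (intro exI[of _ 0] exI[of _ 1] exI[of _ "- 1"]) (auto simp: smul_def split: prod.split)
  next
    case False
    show ?thesis
    proof (cases "p = 2")
      case True
      then have "f (f v) = smul 2 (f v)" for v using f False by (cases v) (auto simp: ops_def)
      \<comment> \<open>Subtracting a doubled projection from the identity negates one coordinate,
        which is an involution.\<close>
      then show ?thesis by (intro exI[of _ 2] exI[of _ "- 1"] exI[of _ "- 1"]) simp
    next
      case 2: False
      then have "f (f v) = smul 1 (f v)" for v using f False by (cases v) (auto simp: ops_def)
      \<comment> \<open>Adding a projection doubles one coordinate; \<open>1 + m\<close> is the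
        inverse of 2 modulo \<open>p ^ c\<close>.\<close>
      moreover obtain m where "int p ^ c = 2 * m + 1" using prime_power_odd[OF 2] by (elim oddE)
      ultimately show ?thesis by (intro exI[of _ 1] exI[of _ 1] exI[of _ m]) simp
    qed
  qed
  then obtain e s m where s: "s = 1 \<or> s = - 1" and ff: "\<And>v. f (f v) = smul e (f v)"
    and d: "int p ^ c dvd s + m + s * m * e" by blast
  have fL: "f v \<in> L" if "v \<in> L" for v
    using box_op[OF _ _ _ f that] abc by (simp add: canonical_def)
  have cL: "smul n v \<in> L" if "int p ^ c dvd n" for n v
    using that abc by (cases v) (auto intro!: dvd_mult2 power_le_dvd[of _ c])
  have comp: "(v + smul i (f v)) + smul j (f (v + smul i (f v))) - v = smul (i + j + i * j * e) (f v)" for i j v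
  proof -
    have "f (v + smul i (f v)) = f v + smul i (smul e (f v))"
      by (simp only: ops_add[OF f] ops_smul[OF f] ff)
    then show ?thesis by (cases v; cases "f v") (simp add: algebra_simps)
  qed
  have "(\<lambda>v. r (v + smul s (f v))) \<in> iso G G"
  proof (rule additive_iso[where g' = "\<lambda>v. v + smul m (f v)"])
    show "u - v + smul n (f (u - v)) = u + smul n (f u) - (v + smul n (f v))" for u v n
      by (cases "f u"; cases "f v") (simp add: ops_diff[OF f] algebra_simps)
    then show "u - v + smul n (f (u - v)) = u + smul n (f u) - (v + smul n (f v))" for u v n .
    show "v + smul n (f v) \<in> L" if "v \<in> L" for v n
      using that by (intro box_add box_smul fL)
    then show "v + smul n (f v) \<in> L" if "v \<in> L" for v n using that .
    show "(v + smul s (f v)) + smul m (f (v + smul s (f v))) - v \<in> L" for v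
      unfolding comp using d by (intro cL)
    show "(v + smul m (f v)) + smul s (f (v + smul m (f v))) - v \<in> L" for v
      unfolding comp using d by (intro cL) (simp add: algebra_simps)
  qed
  with s show ?thesis using that by blast
qed

text \<open>The preimage of \<open>H\<close> contains \<open>v\<close> and its image under an
  automorphism of the form identity plus or minus \<open>f\<close>, hence also their difference,
  which is \<open>f v\<close> up to sign.\<close>

lemma adm_of_characteristic:
  assumes "characteristic H G"
  shows "adm (int p) a b c {v. r v \<in> H}"
proof -
  interpret group G by (rule group_G)
  have H: "subgroup H G" and inv: "\<And>\<phi> v. \<phi> \<in> iso G G \<Longrightarrow> v \<in> H \<Longrightarrow> \<phi> v \<in> H"
    using assms by (auto simp: characteristic_def)
  have "r v \<in> H" if "v \<in> L" for v
    using that subgroup.one_closed[OF H] red_eq_zero_iff[of v] by (simp add: one_G)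
  moreover have diff: "r (u - v) \<in> H" if "r u \<in> H" "r v \<in> H" for u v
  proof -
    have "r u \<otimes>\<^bsub>G\<^esub> inv\<^bsub>G\<^esub> (r v) \<in> H"
      using that H by (simp add: subgroup.m_closed subgroup.m_inv_closed)
    then show ?thesis by (simp add: inv_G mult_G red_add)
  qed
  moreover have "r (f v) \<in> H" if f: "f \<in> ops (int p) a b c" and v: "r v \<in> H" for f v
  proof -
    have 0: "r (0, 0, 0) \<in> H" using subgroup.one_closed[OF H] by (simp add: one_G red_zero)
    obtain s where s: "s = 1 \<or> s = - 1" "(\<lambda>v. r (v + smul s (f v))) \<in> iso G G"
      using op_automorphism[OF f] .
    have "r (r v + smul s (f (r v))) \<in> H" using inv[OF s(2) v] .
    from diff[OF this, of "r v"] have "r (smul s (f (r v))) \<in> H" using v by simp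
    then have "r (smul s (f (r v))) \<in> H \<and> r ((0, 0, 0) - smul s (f (r v))) \<in> H"
      using diff[OF 0] by simp
    then have "r (f (r v)) \<in> H"
      using s(1) by (cases "f (r v)") auto
    moreover have "r (f (r v)) = r (f v)"
      using box_op[OF _ _ _ f red_diff[of v]] abc red_eq_iff[of "f v" "f (r v)"]
      by (simp add: canonical_def ops_diff[OF f])
    ultimately show ?thesis by simp
  qed
  ultimately show ?thesis by (auto simp: adm_def)
qed

section \<open>Matrices of automorphisms\<close>

text \<open>A homomorphism is determined by the images of the unit vectors. Nonnegative coefficients
  permit induction over the naturals and suffice, since reduced representatives have them.\<close>

lemma hom_red:
  assumes \<phi>: "\<phi> \<in> hom G G" and nonneg: "0 \<le> x" "0 \<le> y" "0 \<le> z"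
  shows "\<phi> (r (x, y, z)) =
    r (smul x (\<phi> (r (1, 0, 0))) + (smul y (\<phi> (r (0, 1, 0))) + smul z (\<phi> (r (0, 0, 1)))))"
proof -
  have add: "\<phi> (r (u + v)) = r (\<phi> (r u) + \<phi> (r v))" for u v
    using hom_mult[OF \<phi> red_carrier red_carrier, of u v] by (simp add: mult_G red_add)
  have fixed: "r (\<phi> (r u)) = \<phi> (r u)" for u
    using hom_in_carrier[OF \<phi> red_carrier, of u] by (simp add: mem_carrier)
  have smul_nat: "\<phi> (r (smul (int n) u)) = r (smul (int n) (\<phi> (r u)))" for n u
  proof (induction n)
    case 0
    have "\<phi> \<one>\<^bsub>G\<^esub> = \<one>\<^bsub>G\<^esub>" by (rule hom_one[OF \<phi> group_G group_G])
    then show ?case by (cases u; cases "\<phi> (r u)") (simp add: one_G red_zero)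
  next
    case (Suc n)
    have S: "smul (int (Suc n)) w = smul (int n) w + w" for w
      by (cases w) (simp add: algebra_simps)
    have "\<phi> (r (smul (int (Suc n)) u)) = r (r (smul (int n) (\<phi> (r u))) + r (\<phi> (r u)))"
      unfolding S add Suc.IH fixed ..
    then show ?case unfolding red_add S .
  qed
  have smul_int: "\<phi> (r (smul n u)) = r (smul n (\<phi> (r u)))" if "0 \<le> n" for n u
    using smul_nat[of "nat n" u] that by simp
  have split: "(x, y, z) = smul x (1, 0, 0) + (smul y (0, 1, 0) + smul z (0, 0, 1))"
    by simp
  show ?thesis
    unfolding split add smul_int[OF nonneg(1)] smul_int[OF nonneg(2)] smul_int[OF nonneg(3)]
    by (simp only: red_add)
qed

text \<open>For \<open>p = 2\<close>, injectivity on the elements of order 2 forces the diagonal entries of the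
  matrix of an automorphism to be odd, starting with the largest cyclic factor.\<close>

lemma iso_matrix:
  assumes \<phi>: "\<phi> \<in> iso G G"
  obtains m11 m12 m13 m21 m22 m23 m31 m32 m33 where
    "\<And>x y z. 0 \<le> x \<Longrightarrow> 0 \<le> y \<Longrightarrow> 0 \<le> z \<Longrightarrow> \<phi> (r (x, y, z)) =
      r (x * m11 + y * m12 + z * m13,
         x * (int p ^ (b - a) * m21) + y * m22 + z * m23,
         x * (int p ^ (c - a) * m31) + y * (int p ^ (c - b) * m32) + z * m33)"
    "p = 2 \<Longrightarrow> (a = 0 \<or> odd m11) \<and> odd m22 \<and> odd m33"
proof -
  have hom: "\<phi> \<in> hom G G" and inj: "inj_on \<phi> (carrier G)"
    using \<phi> by (auto simp: iso_def bij_betw_def)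
  obtain e11 e21 e31 where E1: "\<phi> (r (1, 0, 0)) = (e11, e21, e31)" by (metis prod_cases3)
  obtain m12 m22 e32 where E2: "\<phi> (r (0, 1, 0)) = (m12, m22, e32)" by (metis prod_cases3)
  obtain m13 m23 m33 where E3: "\<phi> (r (0, 0, 1)) = (m13, m23, m33)" by (metis prod_cases3)
  have e: "\<phi> (r (x, y, z)) = r (x * e11 + y * m12 + z * m13, x * e21 + y * m22 + z * m23,
      x * e31 + y * e32 + z * m33)" if "0 \<le> x" "0 \<le> y" "0 \<le> z" for x y z
    unfolding hom_red[OF hom that] E1 E2 E3 by (simp add: add.assoc)
  have "\<phi> \<one>\<^bsub>G\<^esub> = \<one>\<^bsub>G\<^esub>" by (rule hom_one[OF hom group_G group_G])
  then have \<phi>0: "\<phi> (0, 0, 0) = (0, 0, 0)" by (simp add: one_G)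
  have cancel: "int p ^ (n - m) dvd x" if "m < n" "int p ^ n dvd int p ^ m * x" for m n x
  proof -
    have "int p ^ n = int p ^ m * int p ^ (n - m)" using that(1) by (simp add: power_add[symmetric])
    then show ?thesis using that(2) p_pos by simp
  qed
  \<comment> \<open>The images of the first two unit vectors are annihilated by \<open>p ^ a\<close>
    and \<open>p ^ b\<close>; this forces the powers of \<open>p\<close> in the entries below the
    diagonal.\<close>
  have "r (int p ^ a, 0, 0) = (0, 0, 0)" "r (0, int p ^ b, 0) = (0, 0, 0)"
    by (simp_all add: red_def)
  then have "r (int p ^ a * e11, int p ^ a * e21, int p ^ a * e31) = (0, 0, 0)"
    "r (int p ^ b * m12, int p ^ b * m22, int p ^ b * e32) = (0, 0, 0)"
    using e[of "int p ^ a" 0 0] e[of 0 "int p ^ b" 0] \<phi>0 by simp_all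
  then have "(int p ^ a * e11, int p ^ a * e21, int p ^ a * e31) \<in> L"
    "(int p ^ b * m12, int p ^ b * m22, int p ^ b * e32) \<in> L"
    by (simp_all only: red_eq_zero_iff)
  then have "int p ^ (b - a) dvd e21" "int p ^ (c - a) dvd e31" "int p ^ (c - b) dvd e32"
    using abc by (auto intro: cancel)
  then obtain m21 m31 m32 where m: "e21 = int p ^ (b - a) * m21" "e31 = int p ^ (c - a) * m31"
      "e32 = int p ^ (c - b) * m32"
    by (elim dvdE)
  \<comment> \<open>Images are reduced residues and hence nonnegative. The kernel vectors built
    below have these quotients in their coordinates, and \<open>ker\<close> needs nonnegative
    arguments.\<close>
  have nonneg: "0 \<le> e21 \<and> 0 \<le> e31" "0 \<le> e32"
    using carrier_nonneg[of e11 e21 e31] carrier_nonneg[of m12 m22 e32]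
      hom_in_carrier[OF hom red_carrier, of "(1, 0, 0)"] hom_in_carrier[OF hom red_carrier, of "(0, 1, 0)"]
    by (simp_all add: E1 E2)
  moreover have "0 \<le> x" if "0 \<le> int p ^ n * x" for n x
    using that mult_le_cancel_left_pos[of "int p ^ n" 0 x] p_pos by simp
  ultimately have m_nonneg: "0 \<le> m21" "0 \<le> m31" "0 \<le> m32"
    unfolding m by blast+
  have ker: "(x, y, z) \<in> L" if "0 \<le> x" "0 \<le> y" "0 \<le> z"
    "(x * e11 + y * m12 + z * m13, x * e21 + y * m22 + z * m23, x * e31 + y * e32 + z * m33) \<in> L" for x y z
  proof -
    have "\<phi> (r (x, y, z)) = \<phi> (0, 0, 0)"
      using that by (simp add: e red_eq_zero_iff \<phi>0)
    then have "r (x, y, z) = (0, 0, 0)"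
      using inj_onD[OF inj] red_carrier by (metis red_zero)
    then show ?thesis by (simp add: red_eq_zero_iff)
  qed
  have odd: "(a = 0 \<or> odd e11) \<and> odd m22 \<and> odd m33" if p2: "p = 2"
  proof -
    define A B C where "A = (2::int) ^ (a - 1)" and "B = (2::int) ^ (b - 1)" and "C = (2::int) ^ (c - 1)"
    have pos: "0 < A" "0 < B" "0 < C" by (simp_all add: A_def B_def C_def)
    have B2: "2 ^ b = 2 * B" and C2: "2 ^ c = 2 * C"
      using abc by (simp_all add: B_def C_def power_Suc[symmetric] del: power_Suc)
    have dv: "2 ^ a dvd B" "2 ^ a dvd C" "2 ^ b dvd C"
      using abc by (auto simp: B_def C_def dvd_power_iff)
    have BC: "B * 2 ^ (c - b) = C" using abc by (simp add: B_def C_def power_add[symmetric])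
    have two_dvd: "2 * y dvd y * x" if "even x" for x y :: int
      using mult_dvd_mono[OF that dvd_refl, of y] by (simp only: mult.commute[of y x])
    have o33: "odd m33"
    proof
      assume "even m33"
      \<comment> \<open>This vector represents the element of order 2 in the last factor; an even
        \<open>m33\<close> would send it to zero.\<close>
      have "(0, 0, C) \<in> L"
        by (rule ker) (use dv pos two_dvd[OF \<open>even m33\<close>, of C] in \<open>simp_all add: p2 C2\<close>)
      then show False using pos by (auto simp: p2 C2 dest: zdvd_imp_le)
    qed
    have o22: "odd m22"
    proof
      assume "even m22"
      \<comment> \<open>The correction \<open>m32 * C\<close> in the third coordinate cancels the
        contribution of \<open>B\<close> there, because \<open>1 + m33\<close> is even.\<close>
      have eq: "B * e32 + m32 * C * m33 = C * (m32 * (1 + m33))"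
        by (simp add: m p2 BC[symmetric] algebra_simps)
      have d: "2 ^ a dvd B * m12 + m32 * C * m13" "2 ^ b dvd B * m22 + m32 * C * m23"
        using dv two_dvd[OF \<open>even m22\<close>, of B] by (simp_all add: B2)
      have d': "2 ^ c dvd B * e32 + m32 * C * m33"
        unfolding eq C2 using o33 by (intro two_dvd) simp
      have "(0, B, m32 * C) \<in> L"
        by (rule ker) (use d d' pos m_nonneg in \<open>simp_all add: p2\<close>)
      then show False using pos by (auto simp: p2 B2 dest: zdvd_imp_le)
    qed
    have o11: "odd e11" if "a \<noteq> 0"
    proof
      assume "even e11"
      have A2: "2 ^ a = 2 * A" using that by (simp add: A_def power_Suc[symmetric] del: power_Suc)
      have AB: "A * 2 ^ (b - a) = B" "A * 2 ^ (c - a) = C"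
        using abc that by (simp_all add: A_def B_def C_def power_add[symmetric])
      \<comment> \<open>In units of \<open>C\<close>, the third coordinate receives
        \<open>m31\<close> from \<open>A\<close> and \<open>m21 * m32\<close> from the correction
        \<open>m21 * B\<close>; \<open>u\<close> cancels their sum.\<close>
      define u where "u = m31 + m21 * m32"
      have eq2: "A * e21 + m21 * B * m22 = B * (m21 * (1 + m22))"
        by (simp add: m p2 AB(1)[symmetric] algebra_simps)
      have eq3: "A * e31 + m21 * B * e32 + u * C * m33 = C * (u * (1 + m33))"
      proof -
        have "A * e31 = C * m31" by (simp add: m p2 AB(2)[symmetric])
        moreover have "m21 * B * e32 = C * (m21 * m32)" by (simp add: m p2 BC[symmetric])
        ultimately show ?thesis by (simp add: u_def algebra_simps)
      qed
      have d: "2 ^ a dvd A * e11 + m21 * B * m12 + u * C * m13"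
        using dv two_dvd[OF \<open>even e11\<close>, of A] by (simp add: A2)
      have "2 ^ b dvd B * (m21 * (1 + m22))" "2 ^ c dvd C * (u * (1 + m33))"
        unfolding B2 C2 using o22 o33 by (intro two_dvd; simp)+
      then have d': "2 ^ b dvd A * e21 + m21 * B * m22 + u * C * m23"
          "2 ^ c dvd A * e31 + m21 * B * e32 + u * C * m33"
        unfolding eq2 eq3 using dv by simp_all
      have "(A, m21 * B, u * C) \<in> L"
        by (rule ker) (use d d' pos m_nonneg in \<open>simp_all add: p2 u_def\<close>)
      then show False using pos by (auto simp: p2 A2 dest: zdvd_imp_le)
    qed
    show ?thesis using o11 o22 o33 by blast
  qed
  show ?thesis
    using that[of e11 m12 m13 m21 m22 m23 m31 m32 m33] e odd unfolding m by blast
qed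

lemma red_mem_adm:
  assumes K: "adm (int p) a b c K"
  shows "r v \<in> K \<longleftrightarrow> v \<in> K"
  using adm_diff[OF K, of v "v - r v"] adm_add[OF K, of "r v" "v - r v"] adm_lattice[OF K] red_diff[of v]
  by auto

text \<open>The off-diagonal part of an automorphism is a combination of shears. Its diagonal part
  is covered by the projections if \<open>p\<close> is odd; if \<open>p = 2\<close>, it differs from
  the identity by even multiples of the coordinates wherever the factor is nontrivial.\<close>

lemma characteristic_of_adm:
  assumes K: "adm (int p) a b c K"
  shows "characteristic (K \<inter> carrier G) G"
proof -
  interpret group G by (rule group_G)
  note r_mem = red_mem_adm[OF K]
  have "subgroup (K \<inter> carrier G) G"
  proof (rule subgroupI)
    show "K \<inter> carrier G \<noteq> {}" using adm_zero[OF K] one_closed by (auto simp: one_G)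
    show "inv\<^bsub>G\<^esub> v \<in> K \<inter> carrier G" if "v \<in> K \<inter> carrier G" for v
      using that inv_G[of v] adm_minus[OF K, of v] by (auto simp: mem_carrier r_mem)
    show "u \<otimes>\<^bsub>G\<^esub> v \<in> K \<inter> carrier G" if "u \<in> K \<inter> carrier G" "v \<in> K \<inter> carrier G" for u v
      using that adm_add[OF K, of u v] by (auto simp: mult_G r_mem)
  qed auto
  moreover have "\<phi> ` (K \<inter> carrier G) = K \<inter> carrier G" if \<phi>: "\<phi> \<in> iso G G" for \<phi>
  \<comment> \<open>The set is finite and \<open>\<phi>\<close> is injective on it, so mapping it
    into itself is enough.\<close>
  proof (rule endo_inj_surj)
    show "finite (K \<inter> carrier G)" using finite_carrier by simp
    show "inj_on \<phi> (K \<inter> carrier G)" using \<phi> by (auto simp: iso_def bij_betw_def inj_on_def)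
    show "\<phi> ` (K \<inter> carrier G) \<subseteq> K \<inter> carrier G"
    proof
      fix w assume "w \<in> \<phi> ` (K \<inter> carrier G)"
      then obtain x y z where w: "w = \<phi> (x, y, z)" and v: "(x, y, z) \<in> K" "(x, y, z) \<in> carrier G"
        by (auto simp del: split_paired_Ex)
      obtain m11 m12 m13 m21 m22 m23 m31 m32 m33 where
        M: "\<And>x y z. 0 \<le> x \<Longrightarrow> 0 \<le> y \<Longrightarrow> 0 \<le> z \<Longrightarrow> \<phi> (r (x, y, z)) =
          r (x * m11 + y * m12 + z * m13,
             x * (int p ^ (b - a) * m21) + y * m22 + z * m23,
             x * (int p ^ (c - a) * m31) + y * (int p ^ (c - b) * m32) + z * m33)"
        and odd: "p = 2 \<Longrightarrow> (a = 0 \<or> odd m11) \<and> odd m22 \<and> odd m33"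
        using iso_matrix[OF \<phi>] by blast
      note add = adm_add[OF K]
      have s: "(n * x, 0, 0) \<in> K" if "(x, 0, 0) \<in> K" for n x
        using adm_smult[OF K that, of n] by simp
      have t: "(0, n * x, 0) \<in> K" if "(0, x, 0) \<in> K" for n x
        using adm_smult[OF K that, of n] by simp
      have u: "(0, 0, n * x) \<in> K" if "(0, 0, x) \<in> K" for n x
        using adm_smult[OF K that, of n] by simp
      note shear = adm_shear[OF K v(1)]
      note off = s[OF shear(1), of m12] s[OF shear(2), of m13] t[OF shear(3), of m23] t[OF shear(4), of m21]
        u[OF shear(5), of m31] u[OF shear(6), of m32]
      have diag: "(x * m11, y * m22, z * m33) \<in> K"
      proof (cases "p = 2")
        case False
        then have d: "(x, 0, 0) \<in> K" "(0, y, 0) \<in> K" "(0, 0, z) \<in> K"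
          using adm_diag[OF K v(1)] by auto
        show ?thesis
          using add[OF add[OF s[OF d(1), of m11] t[OF d(2), of m22]] u[OF d(3), of m33]]
          by (simp add: mult.commute)
      next
        case True
        then have d: "(2 * x, 0, 0) \<in> K" "(0, 2 * y, 0) \<in> K" "(0, 0, 2 * z) \<in> K"
          using adm_diag[OF K v(1)] by auto
        have "(x * (m11 - 1), 0, 0) \<in> K"
        proof (cases "a = 0")
          case True
          \<comment> \<open>The parity of \<open>m11\<close> is unknown when \<open>a = 0\<close>,
            but then the box contains the whole first axis.\<close>
          then show ?thesis using adm_lattice[OF K] by auto
        next
          case False
          with odd[OF \<open>p = 2\<close>] obtain n where "m11 = 2 * n + 1" by (auto elim: oddE)
          then show ?thesis using s[OF d(1), of n] by (simp add: mult_ac)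
        qed
        moreover obtain n where "m22 = 2 * n + 1" using odd[OF True] by (auto elim: oddE)
        then have "(0, y * (m22 - 1), 0) \<in> K" using t[OF d(2), of n] by (simp add: mult_ac)
        moreover obtain n where "m33 = 2 * n + 1" using odd[OF True] by (auto elim: oddE)
        then have "(0, 0, z * (m33 - 1)) \<in> K" using u[OF d(3), of n] by (simp add: mult_ac)
        ultimately show ?thesis
          using add[OF add[OF add[OF v(1)]]] by (force simp: algebra_simps)
      qed
      have "(x * m11 + y * m12 + z * m13,
             x * (int p ^ (b - a) * m21) + y * m22 + z * m23,
             x * (int p ^ (c - a) * m31) + y * (int p ^ (c - b) * m32) + z * m33) =
          (x * m11, y * m22, z * m33) + (m12 * y, 0, 0) + (m13 * z, 0, 0) + (0, m23 * z, 0)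
          + (0, m21 * (int p ^ (b - a) * x), 0) + (0, 0, m31 * (int p ^ (c - a) * x))
          + (0, 0, m32 * (int p ^ (c - b) * y))"
        by (simp add: algebra_simps)
      also have "\<dots> \<in> K" by (intro add diag off)
      finally have "\<phi> (r (x, y, z)) \<in> K"
        using M carrier_nonneg[OF v(2)] by (simp add: r_mem)
      moreover have "\<phi> (x, y, z) \<in> carrier G"
        using \<phi> v(2) by (auto simp: iso_def hom_def)
      ultimately show "w \<in> K \<inter> carrier G"
        using v(2) by (simp add: mem_carrier w)
    qed
  qed
  ultimately show ?thesis by (simp add: characteristic_def)
qed

text \<open>Preimage under \<open>r\<close> and intersection with the carrier are mutually inverse:
  the carrier consists of the fixed points of \<open>r\<close>, and admissible sets are unions of
  cosets of \<open>L\<close>.\<close>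

lemma lattice_iso_Char_adm: "lattice_iso (Char G) {K. adm (int p) a b c K}"
proof -
  define F where "F H = {v. r v \<in> H}" for H
  have res: "F H \<inter> carrier G = H" if "H \<in> Char G" for H
  proof -
    have "H \<subseteq> carrier G" using that by (simp add: Char_def characteristic_def subgroup.subset)
    then show ?thesis by (auto simp: F_def mem_carrier)
  qed
  have ext: "F (K \<inter> carrier G) = K" if "adm (int p) a b c K" for K
    by (simp add: F_def red_mem_adm[OF that])
  have "bij_betw F (Char G) {K. adm (int p) a b c K}"
    using res ext adm_of_characteristic characteristic_of_adm
    by (intro bij_betw_byWitness[where f' = "\<lambda>K. K \<inter> carrier G"]) (auto simp: Char_def F_def)
  moreover have "A \<subseteq> B \<longleftrightarrow> F A \<subseteq> F B" if "A \<in> Char G" "B \<in> Char G" for A B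
    using res[OF that(1)] res[OF that(2)] by (auto simp: F_def)
  ultimately show ?thesis unfolding lattice_iso_def by blast
qed

end

section \<open>Transport along isomorphisms and the conclusion\<close>

lemma lattice_iso_sym:
  assumes "lattice_iso A B"
  shows "lattice_iso B A"
proof -
  obtain f where f: "bij_betw f A B" "\<And>S T. S \<in> A \<Longrightarrow> T \<in> A \<Longrightarrow> S \<subseteq> T \<longleftrightarrow> f S \<subseteq> f T"
    using assms by (auto simp: lattice_iso_def)
  have "bij_betw (inv_into A f) B A" using f(1) by (rule bij_betw_inv_into)
  moreover have "S \<subseteq> T \<longleftrightarrow> inv_into A f S \<subseteq> inv_into A f T" if "S \<in> B" "T \<in> B" for S T
    using f(2)[of "inv_into A f S" "inv_into A f T"] that f(1)
    by (metis bij_betw_imp_surj_on f_inv_into_f inv_into_into)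
  ultimately show ?thesis unfolding lattice_iso_def by blast
qed

lemma lattice_iso_trans:
  assumes "lattice_iso A B" "lattice_iso B C"
  shows "lattice_iso A C"
proof -
  obtain f where f: "bij_betw f A B" "\<And>S T. S \<in> A \<Longrightarrow> T \<in> A \<Longrightarrow> S \<subseteq> T \<longleftrightarrow> f S \<subseteq> f T"
    using assms(1) by (auto simp: lattice_iso_def)
  obtain g where g: "bij_betw g B C" "\<And>S T. S \<in> B \<Longrightarrow> T \<in> B \<Longrightarrow> S \<subseteq> T \<longleftrightarrow> g S \<subseteq> g T"
    using assms(2) by (auto simp: lattice_iso_def)
  have "bij_betw (g \<circ> f) A C" using f(1) g(1) by (rule bij_betw_trans)
  moreover have "S \<subseteq> T \<longleftrightarrow> (g \<circ> f) S \<subseteq> (g \<circ> f) T" if "S \<in> A" "T \<in> A" for S T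
    using f g(2) that by (simp add: bij_betwE)
  ultimately show ?thesis unfolding lattice_iso_def by blast
qed

text \<open>An automorphism of \<open>H\<close> conjugated by \<open>\<phi>\<close> is an
  automorphism of \<open>G\<close>, which fixes \<open>S\<close> as a set.\<close>

lemma characteristic_image:
  assumes "group G" "group H" and \<phi>: "\<phi> \<in> iso G H" and S: "characteristic S G"
  shows "characteristic (\<phi> ` S) H"
proof -
  have sub: "S \<subseteq> carrier G" and S': "subgroup S G"
    using S by (auto simp: characteristic_def dest: subgroup.subset)
  have bij: "bij_betw \<phi> (carrier G) (carrier H)" using \<phi> by (simp add: iso_def)
  have "group_hom G H \<phi>"
    using assms by (simp add: group_hom_def group_hom_axioms_def iso_def)
  then have "subgroup (\<phi> ` S) H" using S' by (rule group_hom.subgroup_img_is_subgroup)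
  moreover have "\<psi> ` \<phi> ` S = \<phi> ` S" if \<psi>: "\<psi> \<in> iso H H" for \<psi>
  proof -
    let ?i = "inv_into (carrier G) \<phi>"
    have "?i \<circ> (\<psi> \<circ> \<phi>) \<in> iso G G"
      using iso_set_trans[OF iso_set_trans[OF \<phi> \<psi>] group.iso_set_sym[OF assms(1) \<phi>]] .
    then have "(?i \<circ> (\<psi> \<circ> \<phi>)) ` S = S"
      using S unfolding characteristic_def by blast
    then have eq: "?i ` \<psi> ` \<phi> ` S = S"
      by (simp only: image_comp o_assoc)
    have "\<psi> ` \<phi> ` S \<subseteq> carrier H"
      using sub bij \<psi> by (auto simp: iso_def hom_def dest: bij_betwE)
    then have "\<psi> ` \<phi> ` S = \<phi> ` ?i ` \<psi> ` \<phi> ` S"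
      using bij by (simp add: image_inv_into_cancel bij_betw_def)
    then show ?thesis unfolding eq .
  qed
  ultimately show ?thesis by (simp add: characteristic_def)
qed

lemma lattice_iso_Char:
  assumes "group G" "group H" and \<phi>: "\<phi> \<in> iso G H"
  shows "lattice_iso (Char G) (Char H)"
proof -
  let ?i = "inv_into (carrier G) \<phi>"
  have i: "?i \<in> iso H G" by (rule group.iso_set_sym[OF assms(1) \<phi>])
  have inj: "inj_on \<phi> (carrier G)" and surj: "\<phi> ` carrier G = carrier H"
    using \<phi> by (auto simp: iso_def bij_betw_def)
  have sub: "S \<in> Char G \<Longrightarrow> S \<subseteq> carrier G" "T \<in> Char H \<Longrightarrow> T \<subseteq> carrier H" for S T
    by (simp_all add: Char_def characteristic_def subgroup.subset)
  have "bij_betw ((`) \<phi>) (Char G) (Char H)"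
  proof (rule bij_betw_byWitness[where f' = "(`) ?i"])
    show "\<forall>S\<in>Char G. ?i ` \<phi> ` S = S" using sub inj by (simp add: inv_into_image_cancel)
    show "\<forall>S\<in>Char H. \<phi> ` ?i ` S = S" using sub surj by (simp add: image_inv_into_cancel)
    show "(`) \<phi> ` Char G \<subseteq> Char H" using characteristic_image[OF assms] by (auto simp: Char_def)
    show "(`) ?i ` Char H \<subseteq> Char G"
      using characteristic_image[OF assms(2,1) i] by (auto simp: Char_def)
  qed
  moreover have "A \<subseteq> B \<longleftrightarrow> \<phi> ` A \<subseteq> \<phi> ` B" if "A \<in> Char G" "B \<in> Char G" for A B
    using inv_into_image_cancel[OF inj sub(1)] that by (metis image_mono)
  ultimately show ?thesis unfolding lattice_iso_def by blast
qed

text \<open>Identifies the rank two group with the three-factor product whose first exponent is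
  0.\<close>

lemma iso_trivial_factor:
  "(\<lambda>v. (0, v)) \<in> iso G (integer_mod_group 1 \<times>\<times> G)"
proof -
  have "carrier (integer_mod_group 1) = {0}"
    by (auto simp: carrier_integer_mod_group)
  then have "(\<lambda>v. (0, v)) ` carrier G = carrier (integer_mod_group 1 \<times>\<times> G)"
    by auto
  then show ?thesis
    by (simp add: iso_def hom_def bij_betw_def inj_on_def)
qed

theorem mainTheorem10:
  fixes p :: nat
  assumes "Factorial_Ring.prime p"
  shows "lattice_iso
           (Char (integer_mod_group (p^2) \<times>\<times> integer_mod_group (p^5)))
           (Char (integer_mod_group p \<times>\<times> (integer_mod_group (p^2) \<times>\<times> integer_mod_group (p^4))))"
proof -
  let ?G = "integer_mod_group (p^2) \<times>\<times> integer_mod_group (p^5)"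
  interpret rank2: prime_power_product p 0 2 5 using assms by unfold_locales auto
  interpret rank3: prime_power_product p 1 2 4 using assms by unfold_locales auto
  have adm: "lattice_iso {K. adm (int p) 0 2 5 K} {K. adm (int p) 1 2 4 K}"
    using lattice_iso_adm_odd[of "int p"] lattice_iso_adm_two assms by (cases "p = 2") auto
  have G: "group ?G" by (intro DirProd_group group_integer_mod_group)
  have prod: "prod_group p 0 2 5 = integer_mod_group 1 \<times>\<times> ?G"
    "prod_group p 1 2 4 = integer_mod_group p \<times>\<times> (integer_mod_group (p^2) \<times>\<times> integer_mod_group (p^4))"
    by (simp_all add: prod_group_def)
  have "lattice_iso (Char ?G) (Char (prod_group p 0 2 5))"
    unfolding prod(1)
    by (rule lattice_iso_Char[OF G _ iso_trivial_factor]) (intro DirProd_group group_integer_mod_group)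
  note lattice_iso_trans[OF this rank2.lattice_iso_Char_adm]
  note lattice_iso_trans[OF this adm]
  note lattice_iso_trans[OF this lattice_iso_sym[OF rank3.lattice_iso_Char_adm]]
  then show ?thesis unfolding prod(2) .
qed

end
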